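(* Let $q$ be a prime power, let $t$ be an even positive integer and let $r\geq 2$ be an integer. Then there exists a scattered $\mathbb{F}_q$-linear set of rank $\frac{rt}{2}$ in $PG(r-1,q^t)$ in each of the following cases: (1) $q=2$ and $t\geq 4$; (2) $q\geq 2$ arbitrary and $t\not\equiv 0 \pmod 3$; (3) $q\equiv 1 \pmod 3$ and $t\equiv 0\pmod 3$.
   Context: Let $V$ be an $r$-dimensional vector space over $\mathbb{F}_{q^t}$ and $PG(r-1,q^t)=PG(V,\mathbb{F}_{q^t})$ the associated projective space. For an $\mathbb{F}_q$-vector subspace $U$ of $V$ of $\mathbb{F}_q$-dimension $k$, the set $L_U=\{\langle u\rangle_{\mathbb{F}_{q^t}} : u\in U\setminus\{0\}\}$ is called an $\mathbb{F}_q$-linear set of rank $k$. The weight of a point $\langle v\rangle_{\mathbb{F}_{q^t}}$ in $L_U$ is $\dim_{\mathbb{F}_q}(U\cap\langle v\rangle_{\mathbb{F}_{q^t}})$. $L_U$ is scattered if every point of $L_U$ has weight $1$, equivalently $|L_U|=q^{k-1}+\dots+q+1$. *)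

theory Defs
  imports Complex_Main "HOL-Library.Cardinality" "HOL-Number_Theory.Number_Theory"
begin

text \<open>
  The extension \<open>\<F>\<^sub>q \<subseteq> \<F>\<^bsub>q^t\<^esub>\<close> is given by two field types and an embedding \<open>\<iota>\<close> between them. An
  \<open>\<F>\<^bsub>q^t\<^esub>\<close>-space then becomes an \<open>\<F>\<^sub>q\<close>-space by restriction of scalars along \<open>\<iota>\<close>, so that
  \<open>\<F>\<^sub>q\<close>-subspaces and \<open>\<F>\<^sub>q\<close>-dimensions are those of the library.
\<close>

definition field_embedding :: "('k::field \<Rightarrow> 'a::field) \<Rightarrow> bool" where
  "field_embedding \<iota> \<longleftrightarrow>
     \<iota> 1 = 1 \<and> (\<forall>x y. \<iota> (x + y) = \<iota> x + \<iota> y) \<and> (\<forall>x y. \<iota> (x * y) = \<iota> x * \<iota> y)"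

definition restrict_scalars ::
    "('k::field \<Rightarrow> 'a::field) \<Rightarrow> ('a \<Rightarrow> 'v::ab_group_add \<Rightarrow> 'v) \<Rightarrow> 'k \<Rightarrow> 'v \<Rightarrow> 'v" where
  "restrict_scalars \<iota> scale = (\<lambda>c v. scale (\<iota> c) v)"

lemma vector_space_restrict_scalars:
  assumes "field_embedding \<iota>" and "vector_space scale"
  shows "vector_space (restrict_scalars \<iota> scale)"
  using assms by (simp add: vector_space_def field_embedding_def restrict_scalars_def)

definition linear_set :: "('a::field \<Rightarrow> 'v::ab_group_add \<Rightarrow> 'v) \<Rightarrow> 'v set \<Rightarrow> 'v set set" where
  "linear_set scale U = {module.span scale {u} | u. u \<in> U - {0}}"

text \<open>A point \<open>P\<close> of the projective space is a one-dimensional \<open>\<F>\<^bsub>q^t\<^esub>\<close>-subspace, as a set of vectors.\<close>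

definition weight ::
    "('k::field \<Rightarrow> 'a::field) \<Rightarrow> ('a \<Rightarrow> 'v::ab_group_add \<Rightarrow> 'v) \<Rightarrow> 'v set \<Rightarrow> 'v set \<Rightarrow> nat" where
  "weight \<iota> scale U P = vector_space.dim (restrict_scalars \<iota> scale) (U \<inter> P)"

definition scattered ::
    "('k::field \<Rightarrow> 'a::field) \<Rightarrow> ('a \<Rightarrow> 'v::ab_group_add \<Rightarrow> 'v) \<Rightarrow> 'v set \<Rightarrow> bool" where
  "scattered \<iota> scale U \<longleftrightarrow> (\<forall>P \<in> linear_set scale U. weight \<iota> scale U P = 1)"

text \<open>The defining subspace is part of the predicate, since weights depend on \<open>U\<close> and not only on \<open>L\<close>.\<close>

definition scattered_linear_set_of_rank ::
    "('k::field \<Rightarrow> 'a::field) \<Rightarrow> ('a \<Rightarrow> 'v::ab_group_add \<Rightarrow> 'v) \<Rightarrow> nat \<Rightarrow> 'v set set \<Rightarrow> bool" where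
  "scattered_linear_set_of_rank \<iota> scale k L \<longleftrightarrow>
     (\<exists>U. module.subspace (restrict_scalars \<iota> scale) U \<and>
          vector_space.dim (restrict_scalars \<iota> scale) U = k \<and>
          L = linear_set scale U \<and> scattered \<iota> scale U)"

end

theory Submission
  imports Defs "HOL-Algebra.Algebraic_Closure_Type" "HOL-Library.Product_Plus" "HOL-Library.Function_Algebras"
begin

text \<open>
  Write \<open>t = 2s\<close>. Direct sums of scattered subspaces are scattered, and \<open>{(x, x^q)}\<close> has rank \<open>t\<close> in
  dimension \<open>2\<close>, so only a subspace of rank \<open>3s\<close> in dimension \<open>3\<close> is missing. Put \<open>K = \<F>\<^bsub>q^s\<^esub>\<close> and
  \<open>\<F>\<^bsub>q^t\<^esub> = K \<oplus> Kw\<close>. If \<open>f\<close> is a semilinear map on a three-dimensional \<open>K\<close>-space \<open>S\<close>, with respect to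
  an automorphism of \<open>K\<close> with fixed field \<open>\<F>\<^sub>q\<close>, that leaves no proper nonzero subspace invariant, then
  \<open>{f x + w x | x \<in> S}\<close> is scattered in \<open>\<F>\<^bsub>q^t\<^esub> \<otimes> S\<close>.

  Such an \<open>f\<close> exists for all \<open>q\<close> and \<open>s\<close>. If \<open>3\<close> does not divide \<open>s\<close>, take \<open>S = \<F>\<^bsub>q^(3s)\<^esub>\<close> and
  \<open>f x = a x^(q^3)\<close>, where the norm \<open>\<mu>\<close> of \<open>a\<close> over \<open>\<F>\<^bsub>q^3\<^esub>\<close> is not in \<open>\<F>\<^sub>q\<close>: the \<open>s\<close>-th iterate of \<open>f\<close> is
  multiplication by \<open>\<mu>\<close>, and \<open>K(\<mu>) = S\<close>. If \<open>3\<close> divides \<open>s\<close>, take \<open>S = K^3\<close> and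
  \<open>f (x, y, z) = (c z^q, x^q, y^q)\<close>, where the norm \<open>\<mu>\<close> of \<open>c \<in> K\<close> over \<open>\<F>\<^bsub>q^3\<^esub>\<close> is not in \<open>\<F>\<^sub>q\<close>: the
  \<open>s\<close>-th iterate of \<open>f\<close> is diagonal with the distinct entries \<open>\<mu>, \<mu>^q, \<mu>^(q^2)\<close>, and \<open>f\<close> permutes the
  coordinate axes cyclically.
\<close>

section \<open>Finite fields as Frobenius-fixed sets, and norms to F_(q^3)\<close>

definition frobenius_fixed :: "nat \<Rightarrow> nat \<Rightarrow> 'b::field set" where
  "frobenius_fixed q n = {x. x ^ (q ^ n) = x}"

text \<open>Under these assumptions raising to the power \<open>q ^ n\<close> is additive, and for n
  > 0 the set \<open>frobenius_fixed q n\<close> is the intersection of the ambient field with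
  F_(q^n) inside an algebraic closure.\<close>

locale char_power =
  fixes q :: nat and ty :: "'b::field itself"
  assumes prime_char: "Factorial_Ring.prime (semiring_char ty)"
    and q_char: "\<exists>e>0. q = semiring_char ty ^ e"
begin

lemma prime_CHAR: "Factorial_Ring.prime CHAR('b)" and q_CHAR: "\<exists>e>0. q = CHAR('b) ^ e"
  using prime_char q_char by (simp_all only: semiring_char_def)

lemma q_gt_1: "q > 1"
  using q_CHAR prime_gt_1_nat[OF prime_CHAR] one_less_power by blast

lemma of_nat_q: "of_nat q = (0::'b)"
  using q_CHAR by (auto simp: of_nat_power)

lemma power_q_add: "((x::'b) + y) ^ (q ^ n) = x ^ (q ^ n) + y ^ (q ^ n)"
proof -
  obtain e where "q = CHAR('b) ^ e" using q_CHAR by blast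
  then have "q ^ n = CHAR('b) ^ (e * n)" by (simp add: power_mult)
  then show ?thesis by (rule freshmans_dream'[OF prime_CHAR])
qed

lemma power_q_0 [simp]: "(0::'b) ^ (q ^ n) = 0"
  using q_gt_1 by simp

lemma power_q_minus: "(- (x::'b)) ^ (q ^ n) = - (x ^ (q ^ n))"
  using power_q_add[of x "- x" n] by (simp add: eq_neg_iff_add_eq_0 add.commute)

lemma power_q_diff: "((x::'b) - y) ^ (q ^ n) = x ^ (q ^ n) - y ^ (q ^ n)"
  using power_q_add[of x "- y" n] by (simp add: power_q_minus)

lemma power_q_inj: "(x::'b) ^ (q ^ n) = y ^ (q ^ n) \<Longrightarrow> x = y"
  using power_q_diff[of x y n] by simp

lemma fixed_iff: "x \<in> frobenius_fixed q n \<longleftrightarrow> x ^ (q ^ n) = (x::'b)"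
  by (simp add: frobenius_fixed_def)

lemma fixed_closed [simp, intro]:
  fixes x y :: 'b
  shows "0 \<in> (frobenius_fixed q n :: 'b set)" "1 \<in> (frobenius_fixed q n :: 'b set)"
    and "x \<in> frobenius_fixed q n \<Longrightarrow> y \<in> frobenius_fixed q n \<Longrightarrow> x + y \<in> frobenius_fixed q n"
    and "x \<in> frobenius_fixed q n \<Longrightarrow> y \<in> frobenius_fixed q n \<Longrightarrow> x - y \<in> frobenius_fixed q n"
    and "x \<in> frobenius_fixed q n \<Longrightarrow> y \<in> frobenius_fixed q n \<Longrightarrow> x * y \<in> frobenius_fixed q n"
    and "x \<in> frobenius_fixed q n \<Longrightarrow> y \<in> frobenius_fixed q n \<Longrightarrow> x / y \<in> frobenius_fixed q n"
    and "x \<in> frobenius_fixed q n \<Longrightarrow> - x \<in> frobenius_fixed q n"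
    and "x \<in> frobenius_fixed q n \<Longrightarrow> x ^ k \<in> frobenius_fixed q n"
proof -
  show "x \<in> frobenius_fixed q n \<Longrightarrow> x ^ k \<in> frobenius_fixed q n"
    by (metis fixed_iff power_mult mult.commute)
qed (auto simp: fixed_iff power_q_add power_q_diff power_q_minus power_mult_distrib power_divide)

lemma power_q_comp: "((x::'b) ^ (q ^ m)) ^ (q ^ n) = x ^ (q ^ (m + n))"
  by (simp add: power_add power_mult)

lemma fixed_mult: "(x::'b) \<in> frobenius_fixed q m \<Longrightarrow> x \<in> frobenius_fixed q (m * k)"
proof (induction k)
  case (Suc k)
  then show ?case using power_q_comp[of x m "m * k"] by (simp add: fixed_iff)
qed (simp add: fixed_iff)

lemma fixed_dvd: "m dvd n \<Longrightarrow> (frobenius_fixed q m :: 'b set) \<subseteq> frobenius_fixed q n"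
  using fixed_mult by (auto elim!: dvdE)

text \<open>The exponent n may be reduced modulo 3. Remainder 1 is the claim; for remainder 2, x =
  x^(q^3) = (x^(q^2))^q = x^q.\<close>

lemma fixed_coprime_3:
  fixes x :: 'b
  assumes "x \<in> frobenius_fixed q 3" "x \<in> frobenius_fixed q n" "\<not> 3 dvd n"
  shows "x \<in> frobenius_fixed q 1"
proof -
  have *: "x ^ (q ^ (n mod 3)) = x"
    using power_q_comp[of x "3 * (n div 3)" "n mod 3"] assms(2) fixed_mult[OF assms(1), of "n div 3"]
    by (simp add: fixed_iff)
  have "n mod 3 = 1 \<or> n mod 3 = 2" using assms(3) by presburger
  then show ?thesis
  proof
    assume "n mod 3 = 2"
    then show ?thesis using * power_q_comp[of x 2 1] assms(1) by (simp add: fixed_iff)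
  qed (use * in \<open>simp add: fixed_iff\<close>)
qed

lemma card_fixed_le:
  assumes "n > 0"
  shows "finite (frobenius_fixed q n :: 'b set)" "card (frobenius_fixed q n :: 'b set) \<le> q ^ n"
proof -
  define p :: "'b poly" where "p = monom 1 (q ^ n) + monom (-1) 1"
  have gt: "q ^ n > 1" using one_less_power[OF q_gt_1] assms by blast
  have deg: "degree p = q ^ n"
    unfolding p_def using gt by (subst degree_add_eq_left) (auto simp: degree_monom_eq)
  then have nz: "p \<noteq> 0" using gt by (metis degree_0 less_nat_zero_code)
  have eq: "frobenius_fixed q n = {x. poly p x = 0}"
    by (auto simp: p_def fixed_iff poly_monom)
  show "finite (frobenius_fixed q n :: 'b set)" "card (frobenius_fixed q n :: 'b set) \<le> q ^ n"
    using poly_roots_finite[OF nz] card_poly_roots_bound[OF nz] deg unfolding eq by auto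
qed

text \<open>This is (q^(3m) - 1) / (q^3 - 1), so that \<open>a ^ norm_exp m\<close> is the norm of a
  from F_(q^(3m)) to F_(q^3).\<close>

abbreviation norm_exp :: "nat \<Rightarrow> nat" where
  "norm_exp m \<equiv> (\<Sum>j<m. q ^ (3 * j))"

text \<open>The geometric sum, arranged without subtraction so that it can be read in
  exponents.\<close>

lemma norm_exp: "norm_exp m * q ^ 3 + 1 = norm_exp m + q ^ (3 * m)"
  by (induction m) (simp_all add: algebra_simps power_add)

text \<open>If all norms from \<open>\<F>\<^bsub>q^(3m)\<^esub>\<close> to \<open>\<F>\<^bsub>q^3\<^esub>\<close> were in \<open>\<F>\<^sub>q\<close>, the polynomial
  \<open>X^(Nq) - X^N\<close> would have more roots than its degree.\<close>

lemma exists_norm_not_in_base: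
  assumes "m > 0" and card: "card (frobenius_fixed q (3 * m) :: 'b set) = q ^ (3 * m)"
  obtains a :: 'b where "a \<in> frobenius_fixed q (3 * m)"
    "a ^ norm_exp m \<in> frobenius_fixed q 3" "a ^ norm_exp m \<notin> frobenius_fixed q 1"
proof -
  let ?N = "norm_exp m"
  have pos: "?N > 0" using \<open>m > 0\<close> q_gt_1 by (auto intro!: sum_pos)
  define p :: "'b poly" where "p = monom 1 (?N * q) + monom (-1) ?N"
  have less: "?N < ?N * q" using pos q_gt_1 by simp
  have deg: "degree p = ?N * q"
    unfolding p_def using less by (subst degree_add_eq_left) (auto simp: degree_monom_eq)
  then have nz: "p \<noteq> 0" using less by (metis degree_0 less_nat_zero_code)
  \<comment> \<open>With N q^3 = N + q^(3m) - 1 this leaves N q < q^(3m), hence fewer roots than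
    field elements.\<close>
  have "?N + ?N * q \<le> ?N * q ^ 3"
  proof -
    have "q * 2 \<le> q * q" "q * q * 1 \<le> q * q * q"
      using q_gt_1 by (intro mult_le_mono2; linarith)+
    then have "1 + q \<le> q ^ 3" using q_gt_1 unfolding power3_eq_cube by linarith
    then have "?N * (1 + q) \<le> ?N * q ^ 3" by (rule mult_le_mono2)
    then show ?thesis by (simp add: distrib_left)
  qed
  then have small: "?N * q < q ^ (3 * m)" using norm_exp[of m] by linarith
  have "\<exists>a \<in> frobenius_fixed q (3 * m). (a::'b) ^ ?N \<notin> frobenius_fixed q 1"
  proof (rule ccontr)
    assume "\<not> ?thesis"
    then have "frobenius_fixed q (3 * m) \<subseteq> {x. poly p x = 0}"
      by (auto simp: p_def poly_monom fixed_iff power_mult)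
    then have "q ^ (3 * m) \<le> card {x. poly p x = 0}"
      using card card_mono[OF poly_roots_finite[OF nz]] by metis
    then show False using card_poly_roots_bound[OF nz] deg small by linarith
  qed
  then obtain a :: 'b where a: "a \<in> frobenius_fixed q (3 * m)" "a ^ ?N \<notin> frobenius_fixed q 1" by blast
  \<comment> \<open>The right-hand side is a^N a, because a lies in F_(q^(3m)); cancelling a nonzero
    a shows that its norm is fixed by the power q^3.\<close>
  have "(a ^ ?N) ^ (q ^ 3) * a = a ^ ?N * a ^ (q ^ (3 * m))"
    by (simp only: power_mult[symmetric] power_add[symmetric] power_Suc2[symmetric]
        norm_exp[unfolded Suc_eq_plus1[symmetric]])
  then have "a ^ ?N \<in> frobenius_fixed q 3"
    using a q_gt_1 pos by (cases "a = 0") (auto simp: fixed_iff power_0_left)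
  with a show ?thesis by (intro that)
qed

text \<open>A quadratic relation for \<open>\<mu>\<close> over \<open>\<F>\<^bsub>q^n\<^esub>\<close> would be shared by its three distinct conjugates.\<close>

lemma cubic_independent:
  fixes \<mu> :: 'b
  assumes \<mu>: "\<mu> \<in> frobenius_fixed q 3" "\<mu> \<notin> frobenius_fixed q 1" and n: "\<not> 3 dvd n"
    and c: "c0 \<in> frobenius_fixed q n" "c1 \<in> frobenius_fixed q n" "c2 \<in> frobenius_fixed q n"
    and eq: "c0 + c1 * \<mu> + c2 * \<mu>\<^sup>2 = 0"
  shows "c0 = 0 \<and> c1 = 0 \<and> c2 = 0"
proof -
  define x where "x = \<mu> ^ (q ^ n)"
  define y where "y = x ^ (q ^ n)"
  have conj: "c0 + c1 * z ^ (q ^ n) + c2 * (z ^ (q ^ n))\<^sup>2 = 0" if "c0 + c1 * z + c2 * z\<^sup>2 = 0" for z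
  proof -
    have "(c0 + c1 * z + c2 * z\<^sup>2) ^ (q ^ n) = 0" unfolding that by simp
    then show ?thesis using c
      by (simp add: power_q_add power_mult_distrib fixed_iff power_mult[symmetric] mult.commute)
  qed
  have x: "c0 + c1 * x + c2 * x\<^sup>2 = 0" using conj[OF eq] by (simp add: x_def)
  have y: "c0 + c1 * y + c2 * y\<^sup>2 = 0" using conj[OF x] by (simp add: y_def)
  have "x \<noteq> \<mu>" using fixed_coprime_3[OF \<mu>(1) _ n] \<mu>(2) by (auto simp: x_def fixed_iff)
  \<comment> \<open>Here y = \<mu>^(q^(2n)), and 3 does not divide 2n either.\<close>
  moreover have "y \<noteq> \<mu>"
    using fixed_coprime_3[OF \<mu>(1), of "n + n"] \<mu>(2) n power_q_comp[of \<mu> n n]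
    by (auto simp: x_def y_def fixed_iff) presburger
  moreover have "x \<noteq> y" using power_q_inj[of \<mu> n x] \<open>x \<noteq> \<mu>\<close> by (auto simp: x_def y_def)
  \<comment> \<open>Subtracting two of the relations produces the factor z - \<mu>. Cancelling it
    for z = x and z = y gives two linear relations, whose difference isolates
    \<open>c2\<close>.\<close>
  moreover have "(z - \<mu>) * (c1 + c2 * (z + \<mu>)) = (c0 + c1 * z + c2 * z\<^sup>2) - (c0 + c1 * \<mu> + c2 * \<mu>\<^sup>2)"
    for z by (simp add: algebra_simps power2_eq_square)
  then have "(x - \<mu>) * (c1 + c2 * (x + \<mu>)) = 0" "(y - \<mu>) * (c1 + c2 * (y + \<mu>)) = 0"
    using eq x y by simp_all
  ultimately have *: "c1 + c2 * (x + \<mu>) = 0" "c1 + c2 * (y + \<mu>) = 0" by auto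
  have "c2 * (x - y) = (c1 + c2 * (x + \<mu>)) - (c1 + c2 * (y + \<mu>))" by (simp add: algebra_simps)
  then have "c2 * (x - y) = 0" using * by simp
  then have "c2 = 0" using \<open>x \<noteq> y\<close> by simp
  then show ?thesis using * eq by simp
qed

end

section \<open>Counting roots and elements of finite fields\<close>

text \<open>The polynomial splits into linear factors; a factor occurring twice would make its root
  a common root with the derivative. So the multiset of roots has no repetition.\<close>

lemma card_roots_separable:
  fixes p :: "'b::alg_closed_field poly"
  assumes "p \<noteq> 0" and sep: "\<And>a. poly p a = 0 \<Longrightarrow> poly (pderiv p) a \<noteq> 0"
  shows "card {a. poly p a = 0} = degree p"
proof -
  obtain A where A: "size A = degree p" "p = smult (lead_coeff p) (\<Prod>x\<in>#A. [:-x, 1:])"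
    using alg_closed_imp_factorization[OF assms(1)] by blast
  have lc: "lead_coeff p \<noteq> 0" using assms(1) by simp
  have roots: "{a. poly p a = 0} = set_mset A"
    using lc by (subst A(2)) (auto simp: poly_prod_mset prod_mset_zero_iff)
  have "count A a \<le> 1" for a
  proof (rule ccontr)
    assume "\<not> count A a \<le> 1"
    then have "{#a, a#} \<subseteq># A" by (simp add: mset_subset_eq_insertD subseteq_mset_def)
    then obtain B where "A = {#a, a#} + B" by (metis mset_subset_eq_exists_conv)
    then have "p = [:-a, 1:] * ([:-a, 1:] * smult (lead_coeff p) (\<Prod>x\<in>#B. [:-x, 1:]))"
      by (subst A(2)) (simp add: mult_smult_right)
    then obtain r where r: "p = [:-a, 1:] * ([:-a, 1:] * r)" by blast
    have "poly p a = 0" "poly (pderiv p) a = 0" unfolding r by (simp_all add: pderiv_mult del: mult_pCons_left)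
    then show False using sep by blast
  qed
  then have "count A a = 1" if "a \<in># A" for a
    using that by (simp add: le_antisym Suc_leI)
  then have "size A = card (set_mset A)" by (simp add: size_multiset_overloaded_eq)
  then show ?thesis using A roots by simp
qed

text \<open>The polynomial X^(q^n) - X is separable: q vanishes in the field, so the derivative is
  the constant -1.\<close>

lemma card_fixed_alg_closed:
  assumes "char_power q TYPE('b::alg_closed_field)" and "n > 0"
  shows "card (frobenius_fixed q n :: 'b set) = q ^ n"
proof -
  interpret char_power q "TYPE('b)" by fact
  define p :: "'b poly" where "p = monom 1 (q ^ n) + monom (-1) 1"
  have gt: "q ^ n > 1" using one_less_power[OF q_gt_1] assms by blast
  have deg: "degree p = q ^ n"
    unfolding p_def using gt by (subst degree_add_eq_left) (auto simp: degree_monom_eq)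
  have eq: "frobenius_fixed q n = {x. poly p x = 0}"
    by (auto simp: p_def fixed_iff poly_monom)
  have "(of_nat (q ^ n) :: 'b) = 0" using \<open>n > 0\<close> by (simp add: of_nat_q)
  then have "poly (pderiv p) a = -1" for a
    by (simp add: p_def pderiv_add pderiv_monom poly_monom)
  then show ?thesis unfolding eq deg[symmetric]
    using gt deg by (intro card_roots_separable) auto
qed

text \<open>Multiplication by a nonzero x permutes the nonzero elements; comparing their products
  before and after gives the exponent.\<close>

lemma finite_field_power_card:
  fixes x :: "'b::{field,finite}"
  shows "x ^ CARD('b) = x"
proof (cases "x = 0")
  case False
  have "prod ((*) x) (UNIV - {0}) = prod id (UNIV - {0})"
    by (rule prod.reindex_bij_witness[of _ "\<lambda>y. y / x" "(*) x"]) (use False in auto)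
  moreover have "prod ((*) x) (UNIV - {0}) = x ^ card (UNIV - {0::'b}) * prod id (UNIV - {0})"
    by (simp add: prod.distrib)
  moreover have "prod id (UNIV - {0::'b}) \<noteq> 0" by simp
  ultimately have "x ^ card (UNIV - {0::'b}) = 1" by simp
  moreover have "CARD('b) = Suc (card (UNIV - {0::'b}))"
    using card_Suc_Diff1[of UNIV "0::'b"] by simp
  ultimately show ?thesis by (metis power_Suc mult_1_right)
qed simp

section \<open>Scattered subspaces and semilinear graphs\<close>

text \<open>Weight one is expressed elementwise: a line through a nonzero u of \<open>U\<close>
  meets \<open>U\<close> only in the F-multiples of u. No dimension over F is involved, so F can be
  a subset of the scalar type.\<close>

definition scattered_subspace :: "'a::field set \<Rightarrow> ('a \<Rightarrow> 'm::ab_group_add \<Rightarrow> 'm) \<Rightarrow> 'm set \<Rightarrow> bool" where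
  "scattered_subspace F scale U \<longleftrightarrow>
     0 \<in> U \<and> (\<forall>u\<in>U. \<forall>v\<in>U. u + v \<in> U) \<and> (\<forall>c\<in>F. \<forall>u\<in>U. scale c u \<in> U) \<and>
     (\<forall>u\<in>U - {0}. \<forall>l. scale l u \<in> U \<longrightarrow> l \<in> F)"

text \<open>Changes the model: from the algebraic closure to triples, and from coordinate functions
  to the given space.\<close>

lemma scattered_subspace_vimage:
  assumes "scattered_subspace F scale U"
    and "T 0 = 0" "\<And>x y. T (x + y) = T x + T y" "\<And>c x. T (scale' c x) = scale c (T x)" "inj T"
  shows "scattered_subspace F scale' (T -` U)"
proof -
  have "T x \<noteq> 0" if "x \<noteq> 0" for x using that assms(2,5) by (metis injD)
  then show ?thesis using assms by (auto simp: scattered_subspace_def)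
qed

text \<open>Writing \<open>l = \<alpha> + \<beta>w\<close> with \<open>\<alpha>, \<beta> \<in> \<F>\<^bsub>q^s\<^esub>\<close>, a relation \<open>l (f x + w x) = f y + w y\<close> expresses
  \<open>f (f x)\<close> as a combination of \<open>x\<close> and \<open>f x\<close> unless \<open>\<beta> = 0\<close>; so \<open>f\<close> would leave invariant a
  nonzero subspace of dimension at most \<open>2\<close>.\<close>

lemma scattered_subspace_semilinear_graph:
  fixes scale :: "'a::field \<Rightarrow> 'm::ab_group_add \<Rightarrow> 'm"
  assumes cp: "char_power q TYPE('a)" and vs: "vector_space scale" and "s > 0"
    and all: "\<And>x::'a. x \<in> frobenius_fixed q (2 * s)"
    and w: "w \<notin> frobenius_fixed q s"
    and \<sigma>: "\<And>c::'a. c \<in> frobenius_fixed q s \<Longrightarrow> c \<in> frobenius_fixed q i \<Longrightarrow> c \<in> frobenius_fixed q 1"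
    and S0: "0 \<in> S" and S_add: "\<And>x y. x \<in> S \<Longrightarrow> y \<in> S \<Longrightarrow> x + y \<in> S"
    and S_scale: "\<And>c x. c \<in> frobenius_fixed q s \<Longrightarrow> x \<in> S \<Longrightarrow> scale c x \<in> S"
    and direct: "\<And>x y. x \<in> S \<Longrightarrow> y \<in> S \<Longrightarrow> x + scale w y = 0 \<Longrightarrow> y = 0"
    and f_S: "\<And>x. x \<in> S \<Longrightarrow> f x \<in> S"
    and f_add: "\<And>x y. x \<in> S \<Longrightarrow> y \<in> S \<Longrightarrow> f (x + y) = f x + f y"
    and f_scale: "\<And>c x. c \<in> frobenius_fixed q s \<Longrightarrow> x \<in> S \<Longrightarrow> f (scale c x) = scale (c ^ (q ^ i)) (f x)"
    and card_S: "card S > (q ^ s)\<^sup>2"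
    and irreducible: "\<And>W x. \<lbrakk>W \<subseteq> S; x \<in> W; x \<noteq> 0; \<And>u v. u \<in> W \<Longrightarrow> v \<in> W \<Longrightarrow> u + v \<in> W;
       \<And>c u. c \<in> frobenius_fixed q s \<Longrightarrow> u \<in> W \<Longrightarrow> scale c u \<in> W; \<And>u. u \<in> W \<Longrightarrow> f u \<in> W\<rbrakk> \<Longrightarrow> S \<subseteq> W"
  shows "scattered_subspace (frobenius_fixed q 1) scale ((\<lambda>x. f x + scale w x) ` S) \<and>
    inj_on (\<lambda>x. f x + scale w x) S" (is "?scattered \<and> ?inj")
proof -
  interpret char_power q "TYPE('a)" by fact
  interpret vector_space scale by fact
  let ?K = "frobenius_fixed q s :: 'a set" and ?u = "\<lambda>x. f x + scale w x"
  have \<sigma>K: "c ^ (q ^ i) \<in> ?K" if "c \<in> ?K" for c using that by simp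
  have S_diff: "x - y \<in> S" if "x \<in> S" "y \<in> S" for x y
    using S_add[OF that(1) S_scale[of "-1" y]] that by simp
  have pair_eq: "x = x' \<and> y = y'"
    if "x \<in> S" "y \<in> S" "x' \<in> S" "y' \<in> S" "x + scale w y = x' + scale w y'" for x y x' y'
  proof -
    have "(x - x') + scale w (y - y') = (x + scale w y) - (x' + scale w y')"
      by (simp add: scale_right_diff_distrib)
    then have "y - y' = 0" using that direct[OF S_diff[of x x'] S_diff[of y y']] by simp
    then show ?thesis using that by simp
  qed
  have inj: ?inj by (rule inj_onI) (use pair_eq f_S in blast)
  have f0: "f 0 = 0" using f_add[OF S0 S0] by simp
  \<comment> \<open>The K-span of x and f x would be invariant, hence contain \<open>S\<close>, yet
    it has at most q^(2s) elements.\<close>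
  have no_rel: False
    if x: "x \<in> S" "x \<noteq> 0" and cd: "c \<in> ?K" "d \<in> ?K" and rel: "f (f x) = scale c (f x) + scale d x" for x c d
  proof -
    define W where "W = (\<lambda>(a, b). scale a x + scale b (f x)) ` (?K \<times> ?K)"
    have W: "scale a x + scale b (f x) \<in> W" if "a \<in> ?K" "b \<in> ?K" for a b
      using that unfolding W_def by force
    have "S \<subseteq> W"
    proof (rule irreducible[where x = x])
      show "W \<subseteq> S" using x by (auto simp: W_def intro!: S_add S_scale f_S)
      show "x \<in> W" using W[of 1 0] by simp
      show "x \<noteq> 0" by fact
    next
      fix u v assume "u \<in> W" "v \<in> W"
      then obtain a b a' b' where "u = scale a x + scale b (f x)" "v = scale a' x + scale b' (f x)"
        and "a \<in> ?K" "b \<in> ?K" "a' \<in> ?K" "b' \<in> ?K" by (auto simp: W_def)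
      then show "u + v \<in> W"
        using W[of "a + a'" "b + b'"] by (simp add: scale_left_distrib add_ac)
    next
      fix e u assume "e \<in> ?K" "u \<in> W"
      then obtain a b where "u = scale a x + scale b (f x)" and "a \<in> ?K" "b \<in> ?K"
        by (auto simp: W_def)
      then show "scale e u \<in> W"
        using W[of "e * a" "e * b"] \<open>e \<in> ?K\<close> by (simp add: scale_right_distrib)
    next
      fix u assume "u \<in> W"
      then obtain a b where u: "u = scale a x + scale b (f x)" and ab: "a \<in> ?K" "b \<in> ?K"
        by (auto simp: W_def)
      have "f u = scale (a ^ (q ^ i)) (f x) + scale (b ^ (q ^ i)) (f (f x))"
        using ab x by (simp add: u f_add f_scale S_scale f_S)
      also have "\<dots> = scale (b ^ (q ^ i) * d) x + scale (a ^ (q ^ i) + b ^ (q ^ i) * c) (f x)"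
        by (simp add: rel scale_right_distrib scale_left_distrib add_ac)
      finally show "f u \<in> W" using W ab cd \<sigma>K by simp
    qed
    then have "card S \<le> card W"
      using card_fixed_le[OF \<open>s > 0\<close>] by (intro card_mono) (auto simp: W_def)
    also have "\<dots> \<le> card (?K \<times> ?K)"
      unfolding W_def using card_fixed_le[OF \<open>s > 0\<close>] by (intro card_image_le) auto
    also have "\<dots> \<le> (q ^ s)\<^sup>2"
      using card_fixed_le[OF \<open>s > 0\<close>] by (simp add: card_cartesian_product power2_eq_square mult_le_mono)
    finally show False using card_S by simp
  qed
  \<comment> \<open>A zero value gives f (f x) = 0, the forbidden relation with both coefficients
    0.\<close>
  have fnz: "f x \<noteq> 0" if "x \<in> S" "x \<noteq> 0" for x
    using no_rel[OF that, of 0 0] by (auto simp: f0)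

  \<comment> \<open>The conjugate of w over K. So \<open>A\<close> is the trace and \<open>B\<close>
    minus the norm of w, which is a root of X^2 - A X - B.\<close>
  define w' where "w' = w ^ (q ^ s)"
  have w'w: "w' \<noteq> w" using w by (simp add: w'_def fixed_iff)
  have conj2: "(x ^ (q ^ s)) ^ (q ^ s) = x" for x :: 'a
    using all[of x] power_q_comp[of x s s] by (simp add: fixed_iff mult_2)
  have w'': "w' ^ (q ^ s) = w" by (simp add: w'_def conj2)
  define A where "A = w + w'"
  define B where "B = - (w * w')"
  have A: "A \<in> ?K" and B: "B \<in> ?K"
    by (simp_all add: A_def B_def fixed_iff power_q_add power_q_minus power_mult_distrib w'' w'_def[symmetric] add.commute mult.commute)
  have ww: "w * w = A * w + B" by (simp add: A_def B_def algebra_simps)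
  \<comment> \<open>Conjugating l = \<alpha> + \<beta> w gives a second equation with w' in place of
    w; the difference of the two determines \<beta>.\<close>
  have split: "\<exists>\<alpha>\<in>?K. \<exists>\<beta>\<in>?K. l = \<alpha> + \<beta> * w" for l
  proof -
    define \<beta> where "\<beta> = (l - l ^ (q ^ s)) / (w - w')"
    have "\<beta> ^ (q ^ s) = (l ^ (q ^ s) - l) / (w' - w)"
      by (simp add: \<beta>_def power_divide power_q_diff conj2 w'' w'_def[symmetric])
    also have "\<dots> = \<beta>" unfolding \<beta>_def by (metis minus_diff_eq minus_divide_divide)
    finally have \<beta>: "\<beta> ^ (q ^ s) = \<beta>" .
    have "l - l ^ (q ^ s) = \<beta> * (w - w')" using w'w by (simp add: \<beta>_def)
    then have "l - \<beta> * w \<in> ?K"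
      by (simp add: fixed_iff power_q_diff power_mult_distrib \<beta> w'_def[symmetric] algebra_simps)
    then show ?thesis using \<beta> by (intro bexI[of _ "l - \<beta> * w"] bexI[of _ \<beta>]) (auto simp: fixed_iff)
  qed

  \<comment> \<open>Comparing components along \<open>S\<close> and w \<open>S\<close> yields
    formulas for f y and for y. Applying f to the latter gives a second expression for f y.\<close>
  have in_F: "l \<in> frobenius_fixed q 1"
    if x: "x \<in> S" "x \<noteq> 0" and y: "y \<in> S" and eq: "scale l (?u x) = ?u y" for l x y
  proof -
    obtain \<alpha> \<beta> where \<alpha>: "\<alpha> \<in> ?K" and \<beta>: "\<beta> \<in> ?K" and l: "l = \<alpha> + \<beta> * w" using split by blast
    have "scale l (?u x) = scale \<alpha> (f x) + scale \<beta> (scale w (f x)) + scale \<alpha> (scale w x) + scale \<beta> (scale (w * w) x)"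
      by (simp add: l scale_left_distrib scale_right_distrib distrib_left add_ac mult_ac)
    also have "\<dots> = (scale \<alpha> (f x) + scale (\<beta> * B) x) + scale w (scale \<beta> (f x) + scale (\<alpha> + \<beta> * A) x)"
      by (simp add: ww scale_left_distrib scale_right_distrib distrib_left distrib_right add_ac mult_ac)
    finally have "scale \<alpha> (f x) + scale (\<beta> * B) x = f y \<and> scale \<beta> (f x) + scale (\<alpha> + \<beta> * A) x = y"
      using x y \<alpha> \<beta> A B eq by (intro pair_eq) (auto intro!: S_add S_scale f_S)
    then have fy: "f y = scale \<alpha> (f x) + scale (\<beta> * B) x"
      and y_eq: "y = scale \<beta> (f x) + scale (\<alpha> + \<beta> * A) x" by auto
    have "\<alpha> + \<beta> * A \<in> ?K" using \<alpha> \<beta> A by simp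
    then have fy': "f y = scale (\<beta> ^ (q ^ i)) (f (f x)) + scale ((\<alpha> + \<beta> * A) ^ (q ^ i)) (f x)"
      unfolding y_eq using \<alpha> \<beta> x by (subst f_add) (auto simp: f_scale f_S intro!: S_scale)
    show ?thesis
    proof (cases "\<beta> = 0")
      case True
      then have "scale (\<alpha> ^ (q ^ i)) (f x) = scale \<alpha> (f x)" using fy fy' by simp
      then have "\<alpha> ^ (q ^ i) = \<alpha>" using fnz[OF x] by simp
      then show ?thesis using \<sigma>[OF \<alpha>] True by (simp add: l fixed_iff)
    next
      case False
      define \<gamma> where "\<gamma> = \<beta> ^ (q ^ i)"
      define \<delta> where "\<delta> = (\<alpha> + \<beta> * A) ^ (q ^ i)"
      have \<gamma>: "\<gamma> \<noteq> 0" using False by (simp add: \<gamma>_def)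
      have "scale \<gamma> (f (f x)) = scale (\<alpha> - \<delta>) (f x) + scale (\<beta> * B) x"
        using fy fy' by (simp add: \<gamma>_def \<delta>_def scale_left_diff_distrib algebra_simps)
      then have "scale (1 / \<gamma>) (scale \<gamma> (f (f x))) = scale (1 / \<gamma>) (scale (\<alpha> - \<delta>) (f x) + scale (\<beta> * B) x)"
        by simp
      then have "f (f x) = scale (1 / \<gamma> * (\<alpha> - \<delta>)) (f x) + scale (1 / \<gamma> * (\<beta> * B)) x"
        using \<gamma> by (simp add: scale_right_distrib)
      moreover have "\<gamma> \<in> ?K" "\<delta> \<in> ?K" using \<alpha> \<beta> A by (auto simp: \<gamma>_def \<delta>_def)
      ultimately have False using \<alpha> \<beta> B by (intro no_rel[OF x]) auto
      then show ?thesis ..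
    qed
  qed

  have K1: "c \<in> ?K" "c ^ (q ^ i) = c" if "c \<in> frobenius_fixed q 1" for c :: 'a
    using that fixed_dvd[of 1 s] fixed_dvd[of 1 i] by (auto simp: fixed_iff[symmetric])
  have ?scattered
    unfolding scattered_subspace_def
  proof (intro conjI ballI allI impI)
    show "0 \<in> ?u ` S" using S0 f0 by (intro image_eqI[of _ _ 0]) auto
  next
    fix u v assume "u \<in> ?u ` S" "v \<in> ?u ` S"
    then obtain x y where "x \<in> S" "y \<in> S" "u = ?u x" "v = ?u y" by auto
    then show "u + v \<in> ?u ` S"
      by (intro image_eqI[of _ _ "x + y"]) (auto simp: f_add scale_right_distrib S_add)
  next
    fix c u assume "c \<in> (frobenius_fixed q 1 :: 'a set)" "u \<in> ?u ` S"
    then obtain x where x: "x \<in> S" "u = ?u x" and c: "c \<in> ?K" "c ^ (q ^ i) = c" using K1 by auto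
    then show "scale c u \<in> ?u ` S"
      by (intro image_eqI[of _ _ "scale c x"]) (simp_all add: f_scale S_scale scale_right_distrib mult.commute)
  next
    fix u and l :: 'a assume "u \<in> ?u ` S - {0}" "scale l u \<in> ?u ` S"
    then obtain x y where "x \<in> S" "y \<in> S" "u = ?u x" "scale l u = ?u y" "u \<noteq> 0" by auto
    then show "l \<in> frobenius_fixed q 1"
      using in_F[of x y l] f0 by (cases "x = 0") auto
  qed
  with inj show ?thesis by blast
qed

section \<open>Scattered subspaces of rank 3s in dimension three\<close>

definition scale3 :: "'a::field \<Rightarrow> 'a \<times> 'a \<times> 'a \<Rightarrow> 'a \<times> 'a \<times> 'a" where
  "scale3 l v = (l * fst v, l * fst (snd v), l * snd (snd v))"

lemma scale3_simp [simp]: "scale3 l (x, y, z) = (l * x, l * y, l * z)"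
  by (simp add: scale3_def)

lemma vector_space_scale3: "vector_space scale3"
  by unfold_locales (auto simp: scale3_def algebra_simps)

text \<open>The coefficients a, a^(q^3), a^(q^6), ... multiply up to a norm. When x is fixed by the
  power q^(3j), the iterate is multiplication by that norm.\<close>

lemma (in char_power) funpow_twisted_frobenius:
  "((\<lambda>x::'b. a * x ^ (q ^ 3)) ^^ j) x = a ^ norm_exp j * x ^ (q ^ (3 * j))"
proof (induction j)
  case (Suc j)
  have "norm_exp j * q ^ 3 + 1 = norm_exp (Suc j)" using norm_exp[of j] by simp
  then have "a * (a ^ norm_exp j) ^ (q ^ 3) = a ^ norm_exp (Suc j)"
    by (metis power_mult power_Suc Suc_eq_plus1)
  moreover have "(x ^ (q ^ (3 * j))) ^ (q ^ 3) = x ^ (q ^ (3 * Suc j))"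
    using power_q_comp[of x "3 * j" 3] by (simp add: add.commute)
  ultimately show ?case using Suc by (simp add: power_mult_distrib mult.assoc[symmetric])
qed simp

lemma funpow_closed: "(\<And>u. u \<in> W \<Longrightarrow> f u \<in> W) \<Longrightarrow> u \<in> W \<Longrightarrow> (f ^^ n) u \<in> W"
  by (induction n) auto

locale quadratic_field =
  fixes q s :: nat and ty :: "'a::{field,finite} itself"
  assumes char_power: "char_power q ty" and s_pos: "s > 0" and card_UNIV_eq: "card (UNIV :: 'a set) = q ^ (2 * s)"
begin

sublocale A: char_power q "TYPE('a)"
  using char_power by (simp add: char_power_def semiring_char_def)

text \<open>The closure makes room for F_(q^(3s)) and F_(q^(6s)), which do not fit into
  \<open>'a\<close>.\<close>

sublocale L: char_power q "TYPE('a alg_closure)"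
  using A.prime_CHAR A.q_CHAR by unfold_locales simp_all

lemma in_fixed [simp]: "(x::'a) \<in> frobenius_fixed q (2 * s)"
  using finite_field_power_card[of x] by (simp add: A.fixed_iff card_UNIV_eq)

lemma to_ac_fixed_iff: "to_ac (x::'a) \<in> frobenius_fixed q n \<longleftrightarrow> x \<in> frobenius_fixed q n"
  by (simp add: A.fixed_iff L.fixed_iff flip: to_ac_power)

lemma card_fixed_L: "n > 0 \<Longrightarrow> card (frobenius_fixed q n :: 'a alg_closure set) = q ^ n"
  by (rule card_fixed_alg_closed) unfold_locales

lemma range_to_ac: "range (to_ac :: 'a \<Rightarrow> _) = frobenius_fixed q (2 * s)"
proof (rule card_subset_eq)
  show "finite (frobenius_fixed q (2 * s) :: 'a alg_closure set)"
    using s_pos by (intro L.card_fixed_le) simp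
  show "card (range (to_ac :: 'a \<Rightarrow> _)) = card (frobenius_fixed q (2 * s) :: 'a alg_closure set)"
    using s_pos by (simp add: card_fixed_L card_image inj_to_ac card_UNIV_eq)
qed (auto simp: to_ac_fixed_iff)

text \<open>Divisibility puts the field F_(q^n) of the closure inside the copy of \<open>'a\<close>,
  so its count carries over.\<close>

lemma card_fixed:
  assumes "n dvd 2 * s"
  shows "card (frobenius_fixed q n :: 'a set) = q ^ n"
proof -
  have "n > 0" using assms s_pos by (auto intro!: Nat.gr0I)
  have "(frobenius_fixed q n :: 'a alg_closure set) \<subseteq> range to_ac"
    using L.fixed_dvd[OF assms] by (simp add: range_to_ac)
  then have "frobenius_fixed q n = to_ac ` (frobenius_fixed q n :: 'a set)"
    using to_ac_fixed_iff by blast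
  then show ?thesis
    using card_fixed_L[OF \<open>n > 0\<close>] card_image[OF inj_on_subset[OF inj_to_ac subset_UNIV]] by metis
qed

lemma exists_outside: "\<exists>w::'a. w \<notin> frobenius_fixed q s"
proof (rule ccontr)
  assume "\<not> ?thesis"
  then have "(frobenius_fixed q s :: 'a set) = UNIV" by blast
  then have "q ^ s = q ^ (2 * s)" using card_fixed[of s] card_UNIV_eq by simp
  then show False using A.q_gt_1 s_pos by simp
qed

text \<open>On \<open>'a\<close> the power q^(2s) is the identity, so the powers q^(3s) and q^s
  agree.\<close>

lemma fixed_3s: "w \<in> frobenius_fixed q (3 * s) \<Longrightarrow> (w::'a) \<in> frobenius_fixed q s"
  using A.power_q_comp[of w "2 * s" s] in_fixed[of w] by (simp add: A.fixed_iff)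

lemma square_less_cube: "(q ^ s)\<^sup>2 < q ^ (3 * s)"
  using A.q_gt_1 s_pos by (simp add: power_mult[symmetric])

lemma exists_scattered_plane_coprime:
  assumes "\<not> 3 dvd s"
  shows "\<exists>U :: ('a \<times> 'a \<times> 'a) set. scattered_subspace (frobenius_fixed q 1) scale3 U \<and> card U = q ^ (3 * s)"
proof -
  let ?K = "frobenius_fixed q s :: 'a set" and ?E = "frobenius_fixed q (3 * s) :: 'a alg_closure set"
  obtain w :: 'a where w: "w \<notin> ?K" using exists_outside by blast
  have cardE: "card ?E = q ^ (3 * s)" using s_pos by (intro card_fixed_L) simp
  have finE: "finite ?E" using s_pos by (intro L.card_fixed_le) simp
  obtain a :: "'a alg_closure" where a: "a \<in> ?E" "a ^ L.norm_exp s \<in> frobenius_fixed q 3"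
    "a ^ L.norm_exp s \<notin> frobenius_fixed q 1"
    using L.exists_norm_not_in_base[OF s_pos cardE] by blast
  define \<mu> where "\<mu> = a ^ L.norm_exp s"
  have \<mu>: "\<mu> \<in> frobenius_fixed q 3" "\<mu> \<notin> frobenius_fixed q 1" using a by (simp_all add: \<mu>_def)
  have \<mu>E: "\<mu> \<in> ?E" using \<mu>(1) L.fixed_dvd[of 3 "3 * s"] by auto
  define scale where "scale = (\<lambda>(l::'a) x. to_ac l * x)"
  have vs: "vector_space scale" by unfold_locales (auto simp: scale_def algebra_simps)
  define f where "f = (\<lambda>x. a * x ^ (q ^ 3))"
  have KE: "to_ac c \<in> ?E" if "c \<in> ?K" for c
    using that to_ac_fixed_iff[of c s] L.fixed_dvd[of s "3 * s"] by auto

  \<comment> \<open>One map describes both fields in the basis 1, \<mu>, \<mu>^2: by counting,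
    coefficients in K give F_(q^(3s)) and coefficients in \<open>'a\<close> give F_(q^(6s)).\<close>
  define T where "T = (\<lambda>(c0::'a, c1::'a, c2::'a). to_ac c0 + to_ac c1 * \<mu> + to_ac c2 * \<mu>\<^sup>2)"
  have T_simp [simp]: "T (c0, c1, c2) = to_ac c0 + to_ac c1 * \<mu> + to_ac c2 * \<mu>\<^sup>2" for c0 c1 c2
    by (simp add: T_def)
  have T0: "T 0 = 0" by (simp add: zero_prod_def)
  have T_add: "T (x + y) = T x + T y" for x y by (cases x; cases y) (simp add: algebra_simps)
  have T_diff: "T (x - y) = T x - T y" for x y by (cases x; cases y) (simp add: algebra_simps)
  have T_scale: "T (scale3 c x) = scale c (T x)" for c x
    by (cases x) (simp add: scale_def algebra_simps)
  have "\<not> 3 dvd 2 * s" using assms by presburger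
  have T_nz: "x = 0" if "T x = 0" for x
    using L.cubic_independent[OF \<mu> \<open>\<not> 3 dvd 2 * s\<close>, of "to_ac (fst x)" "to_ac (fst (snd x))" "to_ac (snd (snd x))"] that
    by (cases x) (simp add: to_ac_fixed_iff zero_prod_def)
  have injT: "inj T"
    using T_nz T_diff by (metis injI right_minus_eq)
  have TK: "T ` (?K \<times> ?K \<times> ?K) = ?E"
  proof (rule card_subset_eq[OF finE])
    show "T ` (?K \<times> ?K \<times> ?K) \<subseteq> ?E" using KE \<mu>E by auto
    show "card (T ` (?K \<times> ?K \<times> ?K)) = card ?E"
      unfolding cardE card_image[OF inj_on_subset[OF injT subset_UNIV]]
      by (simp add: card_cartesian_product card_fixed power3_eq_cube power_mult mult.commute[of 3])
  qed
  have TU: "range T = frobenius_fixed q (6 * s)"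
  proof (rule card_subset_eq)
    show "finite (frobenius_fixed q (6 * s) :: 'a alg_closure set)"
      using s_pos by (intro L.card_fixed_le) simp
    have "to_ac c \<in> frobenius_fixed q (6 * s)" for c :: 'a
      using to_ac_fixed_iff[of c "2 * s"] L.fixed_dvd[of "2 * s" "6 * s"] by auto
    moreover have "\<mu> \<in> frobenius_fixed q (6 * s)" using \<mu>(1) L.fixed_dvd[of 3 "6 * s"] by auto
    ultimately show "range T \<subseteq> frobenius_fixed q (6 * s)" by auto
    have "card (range T) = (q ^ (2 * s)) ^ 3"
      by (simp add: card_image[OF injT] card_prod card_UNIV_eq power3_eq_cube)
    also have "\<dots> = q ^ (6 * s)" by (simp add: power_mult[symmetric])
    finally show "card (range T) = card (frobenius_fixed q (6 * s) :: 'a alg_closure set)"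
      using s_pos by (simp add: card_fixed_L)
  qed

  define U where "U = (\<lambda>x. f x + scale w x) ` ?E"
  have *: "scattered_subspace (frobenius_fixed q 1) scale U \<and> inj_on (\<lambda>x. f x + scale w x) ?E"
    unfolding U_def
  proof (rule scattered_subspace_semilinear_graph[where s = s and i = 3 and S = ?E,
        OF A.char_power_axioms vs s_pos in_fixed w])
    \<comment> \<open>A nonzero y would make w a quotient in F_(q^(3s)), but this field meets
      \<open>'a\<close> only in K.\<close>
    fix x y assume xy: "x \<in> ?E" "y \<in> ?E" "x + scale w y = 0"
    show "y = 0"
    proof (rule ccontr)
      assume "y \<noteq> 0"
      then have "to_ac w = - (x / y)"
        using xy(3) by (simp add: scale_def field_simps eq_neg_iff_add_eq_0)
      then have "to_ac w \<in> ?E" using xy by simp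
      then show False using fixed_3s w by (simp add: to_ac_fixed_iff)
    qed
  next
    fix W x assume W: "W \<subseteq> ?E" "x \<in> W" "x \<noteq> 0"
      and W_add: "\<And>u v. u \<in> W \<Longrightarrow> v \<in> W \<Longrightarrow> u + v \<in> W"
      and W_scale: "\<And>c u. c \<in> ?K \<Longrightarrow> u \<in> W \<Longrightarrow> scale c u \<in> W"
      and W_f: "\<And>u. u \<in> W \<Longrightarrow> f u \<in> W"
    \<comment> \<open>On \<open>?E\<close> the iterate \<open>f ^^ s\<close> is multiplication by
      \<mu>. So W is closed under K[\<mu>], which is all of \<open>?E\<close>.\<close>
    have W_\<mu>: "\<mu> * u \<in> W" if "u \<in> W" for u
    proof -
      have "(f ^^ s) u = \<mu> * u"
        using that W(1) unfolding f_def L.funpow_twisted_frobenius by (auto simp: \<mu>_def L.fixed_iff)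
      then show ?thesis using funpow_closed[of W f u s, OF W_f that] by simp
    qed
    show "?E \<subseteq> W"
    proof
      fix e assume "e \<in> ?E"
      then have "e / x \<in> ?E" using W by auto
      then obtain c0 c1 c2 where c: "c0 \<in> ?K" "c1 \<in> ?K" "c2 \<in> ?K"
        and "e / x = to_ac c0 + to_ac c1 * \<mu> + to_ac c2 * \<mu>\<^sup>2"
        unfolding TK[symmetric] by auto
      then have "e = (to_ac c0 + to_ac c1 * \<mu> + to_ac c2 * \<mu>\<^sup>2) * x"
        using W(3) by (metis nonzero_eq_divide_eq)
      also have "\<dots> = scale c0 x + scale c1 (\<mu> * x) + scale c2 (\<mu> * (\<mu> * x))"
        by (simp add: scale_def algebra_simps power2_eq_square)
      finally show "e \<in> W" using c W(2) by (simp add: W_add W_scale W_\<mu>)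
    qed
  qed (use a cardE square_less_cube KE A.fixed_coprime_3 assms in
      \<open>auto simp: scale_def f_def L.power_q_add algebra_simps power_mult_distrib\<close>)
  have "U \<subseteq> range T"
  proof -
    have E6: "x \<in> frobenius_fixed q (6 * s)" if "x \<in> ?E" for x
      using that L.fixed_dvd[of "3 * s" "6 * s"] by auto
    have "to_ac w \<in> range T" using injT by (intro image_eqI[of _ _ "(w, 0, 0)"]) simp_all
    then show ?thesis
      using a E6 unfolding U_def TU by (auto simp: f_def scale_def)
  qed
  then have "card (T -` U) = card U" by (intro card_vimage_inj injT)
  also have "\<dots> = q ^ (3 * s)" using * cardE by (simp add: U_def card_image)
  finally show ?thesis
    using scattered_subspace_vimage[of _ scale U T scale3, OF conjunct1[OF *] T0 T_add T_scale injT] by blast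
qed

text \<open>Now F_(q^3) lies in K, so \<mu> and its conjugates are scalars, and an eigenvector
  argument over K gives irreducibility.\<close>

lemma exists_scattered_plane_dvd:
  assumes "3 dvd s"
  shows "\<exists>U :: ('a \<times> 'a \<times> 'a) set. scattered_subspace (frobenius_fixed q 1) scale3 U \<and> card U = q ^ (3 * s)"
proof -
  let ?K = "frobenius_fixed q s :: 'a set"
  let ?S = "?K \<times> ?K \<times> ?K"
  obtain w :: 'a where w: "w \<notin> ?K" using exists_outside by blast
  obtain m where s: "s = 3 * m" using assms by blast
  have m: "m > 0" using s_pos s by simp
  have "card (frobenius_fixed q (3 * m) :: 'a set) = q ^ (3 * m)" using s by (intro card_fixed) simp
  then obtain c :: 'a where c: "c \<in> ?K" "c ^ A.norm_exp m \<in> frobenius_fixed q 3"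
    "c ^ A.norm_exp m \<notin> frobenius_fixed q 1"
    using A.exists_norm_not_in_base[OF m] s by blast
  define \<mu> where "\<mu> = c ^ A.norm_exp m"
  have \<mu>: "\<mu> \<in> frobenius_fixed q 3" "\<mu> \<notin> frobenius_fixed q 1" using c by (simp_all add: \<mu>_def)
  \<comment> \<open>This lets f carry the third axis back to the first.\<close>
  have c0: "c \<noteq> 0"
  proof
    assume "c = 0"
    then have "\<mu> = 0 \<or> \<mu> = 1" by (simp add: \<mu>_def power_0_left)
    then show False using \<mu>(2) by auto
  qed
  define \<mu>1 where "\<mu>1 = \<mu> ^ (q ^ 1)"
  define \<mu>2 where "\<mu>2 = \<mu> ^ (q ^ 2)"
  have "\<mu> \<noteq> \<mu>1" using \<mu>(2) by (simp add: \<mu>1_def A.fixed_iff)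
  moreover have "\<mu> \<noteq> \<mu>2" using A.fixed_coprime_3[OF \<mu>(1), of 2] \<mu>(2) by (auto simp: \<mu>2_def A.fixed_iff)
  moreover have "\<mu>1 \<noteq> \<mu>2"
    using A.power_q_inj[of \<mu> 1 \<mu>1] A.power_q_comp[of \<mu> 1 1] \<open>\<mu> \<noteq> \<mu>1\<close>
    by (auto simp: \<mu>1_def \<mu>2_def numeral_2_eq_2)
  ultimately have distinct: "\<mu> \<noteq> \<mu>1" "\<mu> \<noteq> \<mu>2" "\<mu>1 \<noteq> \<mu>2" .
  have "\<mu> \<in> ?K" using \<mu>(1) A.fixed_dvd[of 3 s] assms by auto
  then have \<mu>K: "\<mu> \<in> ?K" "\<mu>1 \<in> ?K" "\<mu>2 \<in> ?K" by (auto simp: \<mu>1_def \<mu>2_def)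

  define f where "f = (\<lambda>(x::'a, y::'a, z::'a). (c * z ^ (q ^ 1), x ^ (q ^ 1), y ^ (q ^ 1)))"
  have f_simp: "f (x, y, z) = (c * z ^ (q ^ 1), x ^ (q ^ 1), y ^ (q ^ 1))" for x y z
    by (simp add: f_def)
  let ?h = "\<lambda>(a::'a) x. a * x ^ (q ^ 3)"
  \<comment> \<open>Three cyclic shifts return each coordinate to its place, leaving twisted
    Frobenius maps with conjugate coefficients.\<close>
  have f3: "(f ^^ 3) (x, y, z) = (?h c x, ?h (c ^ (q ^ 1)) y, ?h (c ^ (q ^ 2)) z)" for x y z
    by (simp add: f_def numeral_3_eq_3 numeral_2_eq_2 power_mult_distrib power_mult)
  have "((f ^^ 3) ^^ j) (x, y, z) =
    ((?h c ^^ j) x, (?h (c ^ (q ^ 1)) ^^ j) y, (?h (c ^ (q ^ 2)) ^^ j) z)" for j x y z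
    by (induction j) (simp_all only: f3 funpow.simps o_apply id_apply)
  then have "((f ^^ 3) ^^ m) (x, y, z) = (c ^ A.norm_exp m * x ^ (q ^ s),
    (c ^ (q ^ 1)) ^ A.norm_exp m * y ^ (q ^ s), (c ^ (q ^ 2)) ^ A.norm_exp m * z ^ (q ^ s))" for x y z
    by (simp only: A.funpow_twisted_frobenius s)
  moreover have "(c ^ k) ^ A.norm_exp m = \<mu> ^ k" for k
    unfolding \<mu>_def by (simp only: power_mult[symmetric] mult.commute)
  ultimately have fs: "((f ^^ 3) ^^ m) (x, y, z) = (\<mu> * x, \<mu>1 * y, \<mu>2 * z)"
    if "x \<in> ?K" "y \<in> ?K" "z \<in> ?K" for x y z
    using that by (simp only: A.fixed_iff \<mu>_def[symmetric] \<mu>1_def \<mu>2_def)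

  define U where "U = (\<lambda>x. f x + scale3 w x) ` ?S"
  have cardS: "card ?S = q ^ (3 * s)"
    by (simp add: card_cartesian_product card_fixed power3_eq_cube power_mult mult.commute[of 3])
  have *: "scattered_subspace (frobenius_fixed q 1) scale3 U \<and> inj_on (\<lambda>x. f x + scale3 w x) ?S"
    unfolding U_def
  proof (rule scattered_subspace_semilinear_graph[where s = s and i = 1 and S = ?S,
        OF A.char_power_axioms vector_space_scale3 s_pos in_fixed w])
    fix x y assume xy: "x \<in> ?S" "y \<in> ?S" "x + scale3 w y = 0"
    have "y' = 0" if "x' \<in> ?K" "y' \<in> ?K" "x' + w * y' = 0" for x' y'
    proof (rule ccontr)
      assume "y' \<noteq> 0"
      then have "w = - (x' / y')" using that(3) by (simp add: field_simps eq_neg_iff_add_eq_0)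
      then show False using w that by simp
    qed
    then show "y = 0" using xy by (cases x; cases y) (auto simp: zero_prod_def)
  next
    fix W v assume W: "W \<subseteq> ?S" "v \<in> W" "v \<noteq> 0"
      and W_add: "\<And>u v. u \<in> W \<Longrightarrow> v \<in> W \<Longrightarrow> u + v \<in> W"
      and W_scale: "\<And>c u. c \<in> ?K \<Longrightarrow> u \<in> W \<Longrightarrow> scale3 c u \<in> W"
      and W_f: "\<And>u. u \<in> W \<Longrightarrow> f u \<in> W"
    \<comment> \<open>Subtracting the scalar a from an iterate with eigenvalues \<mu>,
      \<open>\<mu>1\<close>, \<open>\<mu>2\<close> kills the coordinate whose eigenvalue is
      a.\<close>
    have shift: "((\<mu> - a) * x, (\<mu>1 - a) * y, (\<mu>2 - a) * z) \<in> W"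
      if "(x, y, z) \<in> W" "a \<in> ?K" for x y z a
    proof -
      have "((f ^^ 3) ^^ m) (x, y, z) \<in> W" using W_f that(1) by (intro funpow_closed) auto
      moreover have "scale3 (- a) (x, y, z) \<in> W" using that by (intro W_scale) auto
      ultimately have "((f ^^ 3) ^^ m) (x, y, z) + scale3 (- a) (x, y, z) \<in> W" by (rule W_add)
      moreover have "x \<in> ?K" "y \<in> ?K" "z \<in> ?K" using that W(1) by auto
      ultimately show ?thesis by (simp add: fs algebra_simps)
    qed
    have unit: "scale3 (1 / k) u \<in> W" if "u \<in> W" "k \<in> ?K" for u k using that by (intro W_scale) auto
    have cyc1: "(0, 1, 0) \<in> W" if "(1, 0, 0) \<in> W" using W_f[OF that] A.q_gt_1 by (simp add: f_simp power_0_left)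
    have cyc2: "(0, 0, 1) \<in> W" if "(0, 1, 0) \<in> W" using W_f[OF that] A.q_gt_1 by (simp add: f_simp power_0_left)
    have cyc3: "(1, 0, 0) \<in> W" if "(0, 0, 1) \<in> W"
      using unit[OF W_f[OF that] c(1)] A.q_gt_1 c0 by (simp add: f_simp power_0_left)
    obtain x y z where v: "v = (x, y, z)" by (cases v)
    have K: "x \<in> ?K" "y \<in> ?K" "z \<in> ?K" using W v by auto
    have "x \<noteq> 0 \<or> y \<noteq> 0 \<or> z \<noteq> 0" using W(3) v by (auto simp: zero_prod_def)
    \<comment> \<open>Two shifts, by the eigenvalues of the other two coordinates, isolate a nonzero
      coordinate, and \<open>unit\<close> normalises it to 1.\<close>
    then have "(1, 0, 0) \<in> W \<or> (0, 1, 0) \<in> W \<or> (0, 0, 1) \<in> W"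
    proof (elim disjE)
      assume "x \<noteq> 0"
      then show ?thesis
        using unit[OF shift[OF shift[OF W(2)[unfolded v] \<mu>K(2)] \<mu>K(3)], of "(\<mu> - \<mu>2) * ((\<mu> - \<mu>1) * x)"]
          distinct \<mu>K K by simp
    next
      assume "y \<noteq> 0"
      then show ?thesis
        using unit[OF shift[OF shift[OF W(2)[unfolded v] \<mu>K(1)] \<mu>K(3)], of "(\<mu>1 - \<mu>2) * ((\<mu>1 - \<mu>) * y)"]
          distinct \<mu>K K by simp
    next
      assume "z \<noteq> 0"
      then show ?thesis
        using unit[OF shift[OF shift[OF W(2)[unfolded v] \<mu>K(1)] \<mu>K(2)], of "(\<mu>2 - \<mu>1) * ((\<mu>2 - \<mu>) * z)"]
          distinct \<mu>K K by simp
    qed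
    then have e: "(1, 0, 0) \<in> W" "(0, 1, 0) \<in> W" "(0, 0, 1) \<in> W" using cyc1 cyc2 cyc3 by blast+
    show "?S \<subseteq> W"
    proof clarify
      fix x y z assume "x \<in> ?K" "y \<in> ?K" "z \<in> ?K"
      then have "scale3 x (1, 0, 0) + (scale3 y (0, 1, 0) + scale3 z (0, 0, 1)) \<in> W"
        using e by (intro W_add W_scale)
      then show "(x, y, z) \<in> W" by simp
    qed
  next
    fix x y assume "x \<in> ?S" "y \<in> ?S"
    then show "f (x + y) = f x + f y"
      using A.power_q_add[of _ _ 1] by (cases x; cases y) (simp add: f_simp distrib_left)
  next
    fix x assume "x \<in> ?S"
    then show "f x \<in> ?S" using c(1) by (cases x) (simp add: f_simp)
  qed (use cardS square_less_cube in \<open>auto simp: zero_prod_def f_simp power_mult_distrib\<close>)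
  then have "card U = q ^ (3 * s)" using cardS by (simp add: U_def card_image)
  with * show ?thesis by blast
qed

end

section \<open>Coordinate spaces of any dimension other than one\<close>

definition scale_fun :: "'a::field \<Rightarrow> ('i \<Rightarrow> 'a) \<Rightarrow> 'i \<Rightarrow> 'a" where
  "scale_fun l c = (\<lambda>i. l * c i)"

lemma scale_fun_apply [simp]: "scale_fun l c i = l * c i"
  by (simp add: scale_fun_def)

text \<open>A scattered subspace on coordinates \<open>I\<close> is extended by two coordinates as the direct sum with
  \<open>{(x, x^q)}\<close>.\<close>

lemma (in quadratic_field) scattered_subspace_extend:
  fixes U :: "('i \<Rightarrow> 'a) set"
  assumes U: "scattered_subspace (frobenius_fixed q 1) scale_fun U"
    and supp: "\<forall>c\<in>U. \<forall>b. b \<notin> I \<longrightarrow> c b = 0"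
    and ij: "i \<notin> I" "j \<notin> I" "i \<noteq> j"
  shows "\<exists>U' :: ('i \<Rightarrow> 'a) set. scattered_subspace (frobenius_fixed q 1) scale_fun U' \<and>
    (\<forall>c\<in>U'. \<forall>b. b \<notin> insert i (insert j I) \<longrightarrow> c b = 0) \<and> card U' = card U * q ^ (2 * s)"
proof -
  define U' where "U' = {c. c(i := 0, j := 0) \<in> U \<and> c j = c i ^ q}"
  have add: "(c + d)(i := 0, j := 0) = c(i := 0, j := 0) + d(i := 0, j := 0)" for c d :: "'i \<Rightarrow> 'a"
    by (auto simp: fun_eq_iff)
  have scale: "(scale_fun l c)(i := 0, j := 0) = scale_fun l (c(i := 0, j := 0))" for l and c :: "'i \<Rightarrow> 'a"
    by (auto simp: fun_eq_iff)
  have zero: "(0 :: 'i \<Rightarrow> 'a)(i := 0, j := 0) = 0" by (auto simp: fun_eq_iff)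
  have q1: "(x + y) ^ q = x ^ q + y ^ q" for x y :: 'a using A.power_q_add[of x y 1] by simp
  have "scattered_subspace (frobenius_fixed q 1) scale_fun U'"
    unfolding scattered_subspace_def
  proof (intro conjI ballI allI impI)
    show "0 \<in> U'" using U A.q_gt_1 unfolding U'_def scattered_subspace_def
      by (simp add: zero power_0_left)
  next
    fix c d assume "c \<in> U'" "d \<in> U'"
    then show "c + d \<in> U'"
      using U unfolding U'_def scattered_subspace_def by (simp add: add q1)
  next
    fix l :: 'a and c assume "l \<in> frobenius_fixed q 1" "c \<in> U'"
    then show "scale_fun l c \<in> U'"
      using U unfolding U'_def scattered_subspace_def
      by (simp add: scale A.fixed_iff[of l] power_mult_distrib)
  next
    fix c and l :: 'a assume c: "c \<in> U' - {0}" and l: "scale_fun l c \<in> U'"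
    show "l \<in> frobenius_fixed q 1"
    \<comment> \<open>If the old coordinates do not all vanish, \<open>U\<close> decides. Otherwise
      \<open>c i\<close> is nonzero and l (c i)^q = (l c i)^q forces l^q = l.\<close>
    proof (cases "c(i := 0, j := 0) = 0")
      case False
      then show ?thesis
        using U c l unfolding U'_def scattered_subspace_def mem_Collect_eq scale by blast
    next
      case True
      have "c i \<noteq> 0"
      proof
        assume "c i = 0"
        then have "c j = 0" using c A.q_gt_1 by (simp add: U'_def power_0_left)
        then have "c = c(i := 0, j := 0)" using \<open>c i = 0\<close> by (auto simp: fun_eq_iff)
        then show False using True c by simp
      qed
      moreover have "l * c i ^ q = (l * c i) ^ q" using c l by (simp add: U'_def)
      ultimately show ?thesis by (simp add: power_mult_distrib A.fixed_iff)
    qed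
  qed
  moreover have "\<forall>c\<in>U'. \<forall>b. b \<notin> insert i (insert j I) \<longrightarrow> c b = 0"
  proof (intro ballI allI impI)
    fix c b assume "c \<in> U'" "b \<notin> insert i (insert j I)"
    then have "(c(i := 0, j := 0)) b = 0" using supp unfolding U'_def by blast
    then show "c b = 0" using \<open>b \<notin> insert i (insert j I)\<close> by simp
  qed
  moreover have "bij_betw (\<lambda>(c, x). c(i := x, j := x ^ q)) (U \<times> UNIV) U'"
  proof (rule bij_betw_byWitness[where f' = "\<lambda>c. (c(i := 0, j := 0), c i)"])
    have *: "c(i := 0, j := 0) = c" if "c \<in> U" for c
      using supp that ij by (auto simp: fun_eq_iff)
    have **: "c(i := x, j := x ^ q, i := 0, j := 0) = c" if "c \<in> U" for c x
      using *[OF that] ij by (auto simp: fun_eq_iff split: if_splits)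
    show "\<forall>a\<in>U \<times> UNIV. (\<lambda>c. (c(i := 0, j := 0), c i)) ((\<lambda>(c, x). c(i := x, j := x ^ q)) a) = a"
      using ** ij by auto
    show "\<forall>c\<in>U'. (\<lambda>(c, x). c(i := x, j := x ^ q)) (c(i := 0, j := 0), c i) = c"
      using ij by (auto simp: U'_def fun_eq_iff)
    show "(\<lambda>(c, x). c(i := x, j := x ^ q)) ` (U \<times> UNIV) \<subseteq> U'"
      using ** ij by (auto simp: U'_def)
    show "(\<lambda>c. (c(i := 0, j := 0), c i)) ` U' \<subseteq> U \<times> UNIV" by (auto simp: U'_def)
  qed
  then have "card (U \<times> (UNIV :: 'a set)) = card U'" by (rule bij_betw_same_card)
  then have "card U' = card U * q ^ (2 * s)" by (simp add: card_cartesian_product card_UNIV_eq)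
  ultimately show ?thesis by (intro exI[of _ U'] conjI)
qed

lemma (in quadratic_field) exists_scattered_on_three_coordinates:
  assumes "i \<noteq> j" "i \<noteq> k" "j \<noteq> k"
  shows "\<exists>U :: ('i \<Rightarrow> 'a) set. scattered_subspace (frobenius_fixed q 1) scale_fun U \<and>
    (\<forall>c\<in>U. \<forall>b. b \<notin> {i, j, k} \<longrightarrow> c b = 0) \<and> card U = q ^ (3 * s)"
proof -
  obtain P :: "('a \<times> 'a \<times> 'a) set" where P: "scattered_subspace (frobenius_fixed q 1) scale3 P"
    and card_P: "card P = q ^ (3 * s)"
    using exists_scattered_plane_coprime exists_scattered_plane_dvd by blast
  define g where "g = (\<lambda>(x, y, z) b. if b = i then x else if b = j then y else if b = k then z else (0::'a))"
  define U where "U = g ` P"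
  have add: "g u + g v = g (u + v)" for u v
    by (cases u; cases v) (auto simp: g_def fun_eq_iff)
  have scale: "scale_fun l (g u) = g (scale3 l u)" for l u
    by (cases u) (auto simp: g_def fun_eq_iff)
  have zero: "g 0 = 0" by (auto simp: g_def fun_eq_iff zero_prod_def)
  have inj: "inj g"
  proof (rule injI)
    fix u v assume "g u = g v"
    then have "g u i = g v i" "g u j = g v j" "g u k = g v k" by simp_all
    then show "u = v" using assms by (cases u; cases v) (simp add: g_def)
  qed
  have "scattered_subspace (frobenius_fixed q 1) scale_fun U"
    unfolding scattered_subspace_def
  proof (intro conjI ballI allI impI)
    show "0 \<in> U" using P zero unfolding U_def scattered_subspace_def by (metis image_eqI)
  next
    fix c d assume "c \<in> U" "d \<in> U"
    then show "c + d \<in> U" using P unfolding U_def scattered_subspace_def by (auto simp: add simp del: add_Pair)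
  next
    fix l :: 'a and c assume "l \<in> frobenius_fixed q 1" "c \<in> U"
    then show "scale_fun l c \<in> U" using P unfolding U_def scattered_subspace_def by (auto simp: scale simp del: scale3_simp)
  next
    fix c and l :: 'a assume "c \<in> U - {0}" and l: "scale_fun l c \<in> U"
    then obtain u where u: "c = g u" "u \<in> P" "u \<noteq> 0" using zero unfolding U_def by blast
    then have "g (scale3 l u) \<in> g ` P" using l by (simp only: U_def scale)
    then have "scale3 l u \<in> P" by (simp only: inj_image_mem_iff[OF inj])
    then show "l \<in> frobenius_fixed q 1" using P u unfolding scattered_subspace_def by blast
  qed
  moreover have "\<forall>c\<in>U. \<forall>b. b \<notin> {i, j, k} \<longrightarrow> c b = 0" by (auto simp: U_def g_def)
  moreover have "card U = q ^ (3 * s)"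
    using card_P card_image[OF inj_on_subset[OF inj subset_UNIV]] by (simp add: U_def)
  ultimately show ?thesis by blast
qed

text \<open>Coordinates are removed in pairs, ending at none or at three, since one more removal
  from three would leave a single coordinate. Vectors are functions vanishing off \<open>I\<close>,
  so the dimension can vary within one type.\<close>

lemma (in quadratic_field) exists_scattered_on_coordinates:
  assumes "finite I" "card I \<noteq> 1"
  shows "\<exists>U :: ('i \<Rightarrow> 'a) set. scattered_subspace (frobenius_fixed q 1) scale_fun U \<and>
    (\<forall>c\<in>U. \<forall>b. b \<notin> I \<longrightarrow> c b = 0) \<and> card U = q ^ (card I * s)"
  using assms
proof (induction "card I" arbitrary: I rule: less_induct)
  case less
  consider "card I = 0" | "card I = 3" | "card I \<ge> 2" "card I \<noteq> 3" using less.prems(2) by linarith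
  then show ?case
  proof cases
    case 1
    then have "I = {}" using less.prems by simp
    then show ?thesis by (intro exI[of _ "{0}"]) (auto simp: scattered_subspace_def fun_eq_iff)
  next
    case 2
    then obtain i j k where "I = {i, j, k}" "i \<noteq> j" "i \<noteq> k" "j \<noteq> k" by (auto simp: card_3_iff)
    then show ?thesis using exists_scattered_on_three_coordinates[of i j k] unfolding 2 by simp
  next
    case 3
    then obtain J where J: "J \<subseteq> I" "card J = 2" by (meson obtain_subset_with_card_n)
    then obtain i j where ij: "J = {i, j}" "i \<noteq> j" by (auto simp: card_2_iff)
    define I' where "I' = I - {i, j}"
    have card: "card I' = card I - 2"
      using J ij less.prems(1) by (simp add: I'_def card_Diff_subset)
    have card_I': "card I' < card I" "card I' \<noteq> 1" using card 3 by auto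
    have I: "I = insert i (insert j I')" using J ij by (auto simp: I'_def)
    have I': "i \<notin> I'" "j \<notin> I'" "finite I'" using less.prems by (auto simp: I'_def)
    obtain U :: "('i \<Rightarrow> 'a) set" where U: "scattered_subspace (frobenius_fixed q 1) scale_fun U"
      "\<forall>c\<in>U. \<forall>b. b \<notin> I' \<longrightarrow> c b = 0" "card U = q ^ (card I' * s)"
      using less.hyps[OF _ I'(3)] card_I' by blast
    have "card I = card I' + 2" using card 3 by simp
    then have "card I' * s + 2 * s = card I * s" by (simp only: add_mult_distrib)
    then show ?thesis
      using scattered_subspace_extend[OF U(1,2) I'(1,2) ij(2)] U(3)
      unfolding I by (metis power_add)
  qed
qed

section \<open>Dimension from cardinality, and transfer to the given space\<close>

context vector_space
begin

text \<open>The constructed subspaces have known cardinality; counting coordinate vectors over a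
  basis turns this into their rank.\<close>

lemma card_subspace:
  assumes "finite (UNIV :: 'a set)" "subspace U" "finite U"
  shows "card U = card (UNIV :: 'a set) ^ dim U"
proof -
  obtain B where B: "B \<subseteq> U" "independent B" "U \<subseteq> span B" "card B = dim U"
    using basis_exists by blast
  have fin: "finite B" using B(1) assms(3) finite_subset by blast
  have span: "span B = U" using B assms(2) by (simp add: span_minimal subset_antisym)
  have "bij_betw (\<lambda>c. \<Sum>b\<in>B. scale (c b) b) (PiE B (\<lambda>_. UNIV)) U"
    unfolding bij_betw_def
  proof
    show "inj_on (\<lambda>c. \<Sum>b\<in>B. scale (c b) b) (PiE B (\<lambda>_. UNIV))"
    proof (rule inj_onI)
      fix c d assume cd: "c \<in> PiE B (\<lambda>_. UNIV)" "d \<in> PiE B (\<lambda>_. UNIV)"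
        and eq: "(\<Sum>b\<in>B. scale (c b) b) = (\<Sum>b\<in>B. scale (d b) b)"
      have "(\<Sum>b\<in>B. scale (c b - d b) b) = 0"
        using eq by (simp add: scale_left_diff_distrib sum_subtractf)
      then have "c b - d b = 0" if "b \<in> B" for b
        using B(2) fin that independentD[of B B "\<lambda>b. c b - d b" b] by blast
      then show "c = d" using cd by (intro PiE_ext[OF cd]) simp
    qed
    have "(\<lambda>c. \<Sum>b\<in>B. scale (c b) b) ` (PiE B (\<lambda>_. UNIV)) = range (\<lambda>c. \<Sum>b\<in>B. scale (c b) b)"
    proof (intro equalityI subsetI)
      fix v assume "v \<in> range (\<lambda>c. \<Sum>b\<in>B. scale (c b) b)"
      then obtain c where "v = (\<Sum>b\<in>B. scale (c b) b)" by blast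
      then show "v \<in> (\<lambda>c. \<Sum>b\<in>B. scale (c b) b) ` (PiE B (\<lambda>_. UNIV))"
        by (intro image_eqI[of _ _ "restrict c B"]) auto
    qed auto
    then show "(\<lambda>c. \<Sum>b\<in>B. scale (c b) b) ` (PiE B (\<lambda>_. UNIV)) = U"
      using span_finite[OF fin] span by simp
  qed
  then have "card (PiE B (\<lambda>_. UNIV :: 'a set)) = card U" by (rule bij_betw_same_card)
  then show ?thesis using fin B(4) by (simp add: card_PiE)
qed

end

lemma char_power_CARD:
  assumes "primepow q" "n > 0" "CARD('a::{field,finite}) = q ^ n"
  shows "char_power q TYPE('a)"
proof
  obtain p e where pe: "Factorial_Ring.prime p" "e > 0" "q = p ^ e" using assms(1) by (auto simp: primepow_def)
  have "CHAR('a) > 0" by (rule finite_imp_CHAR_pos) simp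
  then show prime: "Factorial_Ring.prime CHAR('a)" by (rule prime_CHAR_semidom)
  have "CHAR('a) dvd p ^ (e * n)"
    using CHAR_dvd_CARD[where 'a = 'a] assms(3) pe(3) by (simp add: power_mult)
  then have "CHAR('a) dvd p" using prime prime_dvd_power by blast
  then have "CHAR('a) = p" using prime pe(1) by (simp add: primes_dvd_imp_eq)
  then show "\<exists>e>0. q = CHAR('a) ^ e" using pe by blast
qed

text \<open>The image consists of roots of X^q - X and, by injectivity, already has the maximal
  number q of them.\<close>

lemma range_field_embedding:
  fixes \<iota> :: "'k::{field,finite} \<Rightarrow> 'a::field"
  assumes "field_embedding \<iota>" "char_power q TYPE('a)" "CARD('k) = q"
  shows "range \<iota> = frobenius_fixed q 1"
proof -
  interpret char_power q "TYPE('a)" by fact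
  have \<iota>: "\<iota> 1 = 1" "\<And>x y. \<iota> (x + y) = \<iota> x + \<iota> y" "\<And>x y. \<iota> (x * y) = \<iota> x * \<iota> y"
    using assms(1) by (auto simp: field_embedding_def)
  have "inj \<iota>"
  proof (rule injI, rule ccontr)
    fix x y assume eq: "\<iota> x = \<iota> y" and "x \<noteq> y"
    then have "(x - y) * inverse (x - y) = 1" by simp
    then have "\<iota> (x - y) \<noteq> 0" using \<iota>(1) \<iota>(3)[of "x - y" "inverse (x - y)"] by auto
    then show False using \<iota>(2)[of "x - y" y] eq by simp
  qed
  moreover have "\<iota> x ^ n = \<iota> (x ^ n)" for x n by (induction n) (simp_all add: \<iota>)
  then have "\<iota> x \<in> frobenius_fixed q 1" for x
    using finite_field_power_card[of x] assms(3) unfolding fixed_iff by simp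
  then have "range \<iota> \<subseteq> frobenius_fixed q 1" by blast
  ultimately show ?thesis
    using card_fixed_le[of 1] assms(3) by (intro card_seteq) (simp_all add: card_image)
qed

lemma (in vector_space) representation_eq_iff:
  assumes "independent B" "span B = UNIV"
  shows "representation B u = representation B v \<longleftrightarrow> u = v"
  using sum_nonzero_representation_eq[OF assms(1)] assms(2) by (metis UNIV_I)

text \<open>Ensures that preimages under the coordinate map keep their cardinality.\<close>

lemma (in vector_space) representation_surj:
  assumes "independent B" "span B = UNIV" "finite B" "\<And>b. b \<notin> B \<Longrightarrow> c b = 0"
  shows "representation B (\<Sum>b\<in>B. scale (c b) b) = c"
proof (rule representation_eqI[OF assms(1)])
  have sub: "{b. c b \<noteq> 0} \<subseteq> B" using assms(4) by blast
  then show "c b \<noteq> 0 \<Longrightarrow> b \<in> B" for b by blast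
  show "finite {b. c b \<noteq> 0}" using sub assms(3) by (rule finite_subset)
  show "(\<Sum>b | c b \<noteq> 0. scale (c b) b) = (\<Sum>b\<in>B. scale (c b) b)"
    using assms(3) sub by (rule sum.mono_neutral_left) simp
qed (simp add: assms(2))

theorem theorem1p2:
  fixes q t r :: nat
    and \<iota> :: "'k::{field,finite} \<Rightarrow> 'a::{field,finite}"
    and scale :: "'a \<Rightarrow> 'v::ab_group_add \<Rightarrow> 'v"
  assumes "primepow q" and "even t" and "t > 0" and "r \<ge> 2"
    and "CARD('k) = q" and "CARD('a) = q ^ t" and "field_embedding \<iota>"
    and "vector_space scale" and "vector_space.dim scale UNIV = r"
    and "(q = 2 \<and> t \<ge> 4) \<or>
         (q \<ge> 2 \<and> \<not> [t = 0] (mod 3)) \<or>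
         ([q = 1] (mod 3) \<and> [t = 0] (mod 3))"
  shows "\<exists>L. scattered_linear_set_of_rank \<iota> scale (r * t div 2) L"
proof -
  obtain s where t: "t = 2 * s" using \<open>even t\<close> by blast
  have cp: "char_power q TYPE('a)" using assms(1,3,6) by (rule char_power_CARD)
  interpret quadratic_field q s "TYPE('a)"
    using cp assms(3,6) t by (intro quadratic_field.intro) auto
  interpret V: vector_space scale by fact
  interpret K: vector_space "restrict_scalars \<iota> scale"
    using assms(7,8) by (rule vector_space_restrict_scalars)
  have range_\<iota>: "range \<iota> = frobenius_fixed q 1" using assms(7) cp assms(5) by (rule range_field_embedding)
  obtain B where B: "V.independent B" "V.span B = UNIV" "card B = r"
    using V.basis_exists[of UNIV] assms(9) by (metis top.extremum_uniqueI)
  \<comment> \<open>An infinite set has \<open>card\<close> 0, which r \<ge> 2 excludes.\<close>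
  then have "finite B" using assms(4) by (metis card.infinite not_numeral_le_zero)
  then obtain C :: "('v \<Rightarrow> 'a) set" where C: "scattered_subspace (frobenius_fixed q 1) scale_fun C"
    "\<And>c b. c \<in> C \<Longrightarrow> b \<notin> B \<Longrightarrow> c b = 0" "card C = q ^ (r * s)"
    using exists_scattered_on_coordinates[of B] B(3) assms(4) by fastforce
  define T where "T = V.representation B"
  define U where "U = T -` C"
  have inj: "inj T" using V.representation_eq_iff[OF B(1,2)] by (simp add: inj_def T_def)
  have "scattered_subspace (frobenius_fixed q 1) scale U"
    unfolding U_def using B(2) inj
    by (intro scattered_subspace_vimage[OF C(1)])
      (auto simp: T_def V.representation_zero V.representation_add[OF B(1)] V.representation_scale[OF B(1)] fun_eq_iff)
  then have U: "0 \<in> U" "\<And>u v. u \<in> U \<Longrightarrow> v \<in> U \<Longrightarrow> u + v \<in> U"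
    "\<And>k u. u \<in> U \<Longrightarrow> scale (\<iota> k) u \<in> U"
    "\<And>u l. u \<in> U \<Longrightarrow> u \<noteq> 0 \<Longrightarrow> scale l u \<in> U \<Longrightarrow> l \<in> range \<iota>"
    unfolding scattered_subspace_def range_\<iota>[symmetric] by auto
  have "c \<in> range T" if "c \<in> C" for c
    using V.representation_surj[OF B(1,2) \<open>finite B\<close>, of c] C(2)[OF that] unfolding T_def
    by (metis rangeI)
  then have "card U = card C" unfolding U_def by (intro card_vimage_inj inj) blast
  then have card_U: "card U = q ^ (r * s)" using C(3) by simp
  have "finite U" using card_U A.q_gt_1 by (intro card_ge_0_finite) simp
  have sub: "K.subspace U" unfolding K.subspace_def by (simp add: restrict_scalars_def U)
  have "q ^ K.dim U = q ^ (r * s)"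
    using K.card_subspace[OF _ sub \<open>finite U\<close>] card_U assms(5) by simp
  then have dim: "K.dim U = r * t div 2" using A.q_gt_1 t by simp
  have "scattered \<iota> scale U"
    unfolding scattered_def linear_set_def weight_def
  proof
    fix P assume "P \<in> {V.span {u} | u. u \<in> U - {0}}"
    then obtain u where P: "P = V.span {u}" and u: "u \<in> U" "u \<noteq> 0" by blast
    \<comment> \<open>The scalars carrying u into \<open>U\<close> are exactly those in the range of
      \<iota>.\<close>
    have "U \<inter> V.span {u} = K.span {u}"
      unfolding V.span_singleton K.span_singleton unfolding restrict_scalars_def
      using U(3)[OF u(1)] U(4)[OF u] by blast
    then show "K.dim (U \<inter> P) = 1"
      using P u K.dim_span_eq_card_independent[of "{u}"] by (simp add: K.dependent_single)
  qed
  with sub dim show ?thesis unfolding scattered_linear_set_of_rank_def by blast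
qed

end
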